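(* Let $T>0$. For every $\mu\in\mathcal{M}^{+}((0,T])$ and every $\rho_0\in\mathcal{M}^{+}([0,1))$ with zero singular continuous parts, the unique weak solution $\rho\colon[0,T]\to\mathcal{M}^{+}([0,1))$ with initial condition $\rho_0$ and influx $\mu$ satisfies: for every initial condition $\tilde\rho_0\in\mathcal{M}^{+}([0,1))$ (with zero singular continuous part), with $t\mapsto\tilde\rho_t$ denoting the unique weak solution with initial condition $\tilde\rho_0$ and the same influx $\mu$, and for every $\varepsilon>0$, there exist $\delta>0$ and $\tau>0$ such that if $\phi(\tilde\rho_0-\rho_0)<\delta$ and $t\in[0,T]$ with $t<\tau$, then $\phi(\tilde\rho_t-\rho_t)<\varepsilon$.
   Context: For an interval $I\subseteq\mathbb{R}$, $\mathcal{M}(I)$ and $\mathcal{M}^{+}(I)$ denote the signed, respectively nonnegative, finite Borel measures on $I$. The velocity $\alpha\colon[0,\infty)\to(0,1]$ is a fixed strictly decreasing, Lipschitz continuous function with $\alpha(0)=1$. Seminorm $\phi$: let $\mathcal{F}$ be the set of functions $f\colon[0,1)\to[0,1]$ with $|f(x)-f(y)|\le|x-y|$ for all $x,y\in[0,1)$; let $h(x)=\frac12-\left|\frac12-x\right|$ for $x\in[0,1)$ and $h(x)=0$ otherwise. For $\nu\in\mathcal{M}([0,1))$ put $\phi(\nu)=\sup_{f\in\mathcal{F}}\left|\int_{[0,1)}f h\,d\nu\right|$. Weak solution with initial condition $\rho_0$ and influx (boundary condition) $\mu$: a function $\rho\colon[0,T]\to\mathcal{M}^{+}([0,1))$ such that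 $W\colon t\mapsto\rho_t([0,1))$ is integrable and, for every $\tau\in[0,T]$ and $\varphi\in\Psi$, $$0=\int_{(0,\tau]}\int_{[0,1)}\bigl(\partial_t\varphi+\alpha(W(t))\,\partial_x\varphi\bigr)(t,x)\,d\rho_t(x)\,dt+\int_{(0,\tau]}\varphi(t,0)\,d\mu(t)-\int_{[0,1)}\varphi(\tau,x)\,d\rho_\tau(x)+\int_{[0,1)}\varphi(0,x)\,d\rho_0(x),$$ where $\Psi$ is the set of $\varphi\colon[0,T]\times[0,1]\to\mathbb{R}$ such that for every $t$, $\varphi(t,1)=0$ and $\varphi(t,\cdot)$ is differentiable, $\partial_x\varphi$ is jointly continuous, and for every $x\in[0,1)$, $\varphi(\cdot,x)$ is Lipschitz continuous. The paper establishes that the weak solution is unique and coincides with the unique Lagrangian solution, i.e. the curve $\rho\colon[0,T]\to\mathcal{M}^{+}([0,1))$ such that for every $t\in[0,T]$ and Borel $E\subseteq[0,1)$ $$\rho_t(E)=\int_{[0,1)}\chi_E(X(t;0,x_0))\,d\rho_0(x_0)+\int_{(0,t]}\chi_E(X(t;s,0))\,d\mu(s),$$ where $\chi_E$ is the indicator function of $E$ and $X$ is the semiflow of the vector field $v(t,x)=\alpha(\rho_t([0,1)))$: for $0\le r\le t\le T$ and $x_0\ge0$, $X(r;r,x_0)=x_0$ and $t\mapsto X(t;r,x_0)$ is absolutely continuous with $\frac{\partial}{\partial t}X(t;r,x_0)=\alpha(\rho_t([0,1)))$ for almost every $t\in[r,T]$. *)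

theory Defs
  imports "HOL-Analysis.Analysis"
begin

definition finite_measures_on :: "real set \<Rightarrow> real measure set" where
  "finite_measures_on I = {M. sets M = sets (restrict_space borel I) \<and> finite_measure M}"

definition velocity :: "(real \<Rightarrow> real) \<Rightarrow> bool" where
  "velocity \<alpha> \<longleftrightarrow> \<alpha> 0 = 1 \<and> \<alpha> ` {0..} \<subseteq> {0<..1} \<and> strict_antimono_on {0..} \<alpha>
     \<and> (\<exists>L. L-lipschitz_on {0..} \<alpha>)"

text \<open>Lebesgue decomposition into absolutely continuous, singular continuous and pure point
  part. The three parts are unique as measures.\<close>

definition lebesgue_decomposition ::
  "real set \<Rightarrow> real measure \<Rightarrow> real measure \<Rightarrow> real measure \<Rightarrow> real measure \<Rightarrow> bool" where
  "lebesgue_decomposition I M Mac Msc Mpp \<longleftrightarrow>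
     Mac \<in> finite_measures_on I \<and> Msc \<in> finite_measures_on I \<and> Mpp \<in> finite_measures_on I \<and>
     absolutely_continuous (restrict_space lborel I) Mac \<and>
     (\<forall>x\<in>I. emeasure Msc {x} = 0) \<and>
     (\<exists>N\<in>null_sets (restrict_space lborel I). emeasure Msc (I - N) = 0) \<and>
     (\<exists>C\<subseteq>I. countable C \<and> emeasure Mpp (I - C) = 0) \<and>
     (\<forall>E\<in>sets M. emeasure M E = emeasure Mac E + emeasure Msc E + emeasure Mpp E)"

definition zero_sing_cont_part :: "real set \<Rightarrow> real measure \<Rightarrow> bool" where
  "zero_sing_cont_part I M \<longleftrightarrow>
     (\<exists>Mac Msc Mpp. lebesgue_decomposition I M Mac Msc Mpp \<and> emeasure Msc I = 0)"

text \<open>A finite signed Borel measure on \<open>I\<close> is represented by its real-valued set function on the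
  Borel subsets of \<open>I\<close>, and integration against it is defined through the Jordan decomposition.\<close>

definition jordan_decomposition ::
  "real set \<Rightarrow> (real set \<Rightarrow> real) \<Rightarrow> real measure \<Rightarrow> real measure \<Rightarrow> bool" where
  "jordan_decomposition I \<nu> P N \<longleftrightarrow>
     P \<in> finite_measures_on I \<and> N \<in> finite_measures_on I \<and>
     (\<exists>A\<in>sets (restrict_space borel I). measure P (I - A) = 0 \<and> measure N A = 0) \<and>
     (\<forall>E\<in>sets (restrict_space borel I). \<nu> E = measure P E - measure N E)"

definition signed_integral :: "real set \<Rightarrow> (real set \<Rightarrow> real) \<Rightarrow> (real \<Rightarrow> real) \<Rightarrow> real" where
  "signed_integral I \<nu> f =
     (let (P, N) = SOME (P, N). jordan_decomposition I \<nu> P N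
      in (LINT x|P. f x) - (LINT x|N. f x))"

definition signed_diff :: "real measure \<Rightarrow> real measure \<Rightarrow> real set \<Rightarrow> real" where
  "signed_diff M N = (\<lambda>E. measure M E - measure N E)"

definition lip_functions :: "(real \<Rightarrow> real) set" where
  "lip_functions = {f. (\<forall>x\<in>{0..<1}. f x \<in> {0..1}) \<and>
     (\<forall>x\<in>{0..<1}. \<forall>y\<in>{0..<1}. \<bar>f x - f y\<bar> \<le> \<bar>x - y\<bar>)}"

definition hat :: "real \<Rightarrow> real" where
  "hat x = (if x \<in> {0..<1} then 1/2 - \<bar>1/2 - x\<bar> else 0)"

definition phi :: "(real set \<Rightarrow> real) \<Rightarrow> real" where
  "phi \<nu> = (SUP f\<in>lip_functions. \<bar>signed_integral {0..<1} \<nu> (\<lambda>x. f x * hat x)\<bar>)"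

text \<open>Partial derivatives of functions on \<open>[0,T] \<times> [0,1]\<close>; they are one-sided at the boundary.\<close>

definition deriv_t :: "real \<Rightarrow> (real \<Rightarrow> real \<Rightarrow> real) \<Rightarrow> real \<Rightarrow> real \<Rightarrow> real" where
  "deriv_t T \<phi> t x = vector_derivative (\<lambda>s. \<phi> s x) (at t within {0..T})"

definition deriv_x :: "(real \<Rightarrow> real \<Rightarrow> real) \<Rightarrow> real \<Rightarrow> real \<Rightarrow> real" where
  "deriv_x \<phi> t x = vector_derivative (\<phi> t) (at x within {0..1})"

definition test_functions :: "real \<Rightarrow> (real \<Rightarrow> real \<Rightarrow> real) set" where
  "test_functions T = {\<phi>.
     (\<forall>t\<in>{0..T}. \<phi> t 1 = 0 \<and> \<phi> t differentiable_on {0..1}) \<and>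
     continuous_on ({0..T} \<times> {0..1}) (\<lambda>(t, x). deriv_x \<phi> t x) \<and>
     (\<forall>x\<in>{0..<1}. \<exists>L. L-lipschitz_on {0..T} (\<lambda>t. \<phi> t x))}"

abbreviation mass :: "(real \<Rightarrow> real measure) \<Rightarrow> real \<Rightarrow> real" where
  "mass \<rho> t \<equiv> measure (\<rho> t) {0..<1}"

text \<open>The Lipschitz constant of \<open>\<phi>(\<cdot>, x)\<close> may depend on \<open>x\<close>, so \<open>\<partial>\<^sub>t\<phi>\<close> may be unbounded and its
  integral against \<open>d\<rho>\<^sub>t(x) dt\<close> may fail to exist. The weak identity is required exactly for those
  test functions for which this integral exists. The guard concerns the \<open>\<partial>\<^sub>t\<phi>\<close> term only: existence
  of the remaining integrals is part of being a weak solution, and expresses measurability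
  of \<open>t \<mapsto> \<rho>\<^sub>t\<close>.\<close>

definition deriv_t_integrable ::
  "real \<Rightarrow> (real \<Rightarrow> real measure) \<Rightarrow> (real \<Rightarrow> real \<Rightarrow> real) \<Rightarrow> real \<Rightarrow> bool" where
  "deriv_t_integrable T \<rho> \<phi> \<tau> \<longleftrightarrow>
     (AE t in lebesgue. t \<in> {0<..\<tau>} \<longrightarrow> integrable (\<rho> t) (deriv_t T \<phi> t)) \<and>
     set_integrable lebesgue {0<..\<tau>} (\<lambda>t. LINT x|\<rho> t. \<bar>deriv_t T \<phi> t x\<bar>)"

definition weak_solution ::
  "real \<Rightarrow> (real \<Rightarrow> real) \<Rightarrow> real measure \<Rightarrow> real measure \<Rightarrow> (real \<Rightarrow> real measure) \<Rightarrow> bool" where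
  "weak_solution T \<alpha> \<mu> \<rho>0 \<rho> \<longleftrightarrow>
     (\<forall>t\<in>{0..T}. \<rho> t \<in> finite_measures_on {0..<1}) \<and>
     set_integrable lebesgue {0..T} (mass \<rho>) \<and>
     (\<forall>\<tau>\<in>{0..T}. \<forall>\<phi>\<in>test_functions T. deriv_t_integrable T \<rho> \<phi> \<tau> \<longrightarrow>
        set_integrable lebesgue {0<..\<tau>}
          (\<lambda>t. LINT x|\<rho> t. deriv_t T \<phi> t x + \<alpha> (mass \<rho> t) * deriv_x \<phi> t x) \<and>
        0 = (LINT t:{0<..\<tau>}|lebesgue.
               (LINT x|\<rho> t. deriv_t T \<phi> t x + \<alpha> (mass \<rho> t) * deriv_x \<phi> t x))
          + (LINT t:{0<..\<tau>}|\<mu>. \<phi> t 0)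
          - (LINT x|\<rho> \<tau>. \<phi> \<tau> x)
          + (LINT x|\<rho>0. \<phi> 0 x))"

end

theory Submission
  imports Defs
begin

text \<open>Testing the weak formulation with a time-independent \<open>C\<^sup>1\<close> function \<open>g\<close> with \<open>g 1 = 0\<close> and
  \<open>\<bar>g'\<bar> \<le> L\<close> bounds \<open>\<bar>\<integral>g d\<rho>\<^sub>t - \<integral>g d\<rho>\<^sub>0\<bar>\<close> by \<open>L \<integral>\<^sub>0\<^sup>t W\<close> plus the influx term \<open>\<bar>g 0\<bar> \<mu>((0,t])\<close>. The
  functions \<open>f h\<close> in the definition of \<open>\<phi>\<close> are \<open>2\<close>-Lipschitz and vanish at \<open>0\<close> and \<open>1\<close>, so
  approximating them by such \<open>g\<close> removes the influx term and yields
  \<open>\<phi>(\<rho>'\<^sub>t - \<rho>\<^sub>t) \<le> \<phi>(\<rho>'\<^sub>0 - \<rho>\<^sub>0) + 2 \<integral>\<^sub>0\<^sup>t (W + W')\<close>, where the integral tends to \<open>0\<close> with \<open>t\<close>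
  because \<open>W\<close> and \<open>W'\<close> are integrable.\<close>

section \<open>Integrals determined by the measures of sets\<close>

lemma finite_measures_onD:
  assumes "M \<in> finite_measures_on I"
  shows "finite_measure M" "sets M = sets (restrict_space borel I)" "space M = I"
  using assms sets_eq_imp_space_eq[of M "restrict_space borel I"]
  by (auto simp: finite_measures_on_def space_restrict_space)

text \<open>The set identity is carried from indicators to all nonnegative measurable functions by
  the standard induction. The additive form of the signed identity \<open>A - D = C - B\<close>
  avoids subtraction in \<open>ennreal\<close>, which is truncated.\<close>

lemma nn_integral_add_eq_add:
  assumes sets: "sets A = sets C" "sets B = sets C" "sets D = sets C"
    and eq: "\<And>E. E \<in> sets C \<Longrightarrow> emeasure A E + emeasure B E = emeasure C E + emeasure D E"
    and f: "f \<in> borel_measurable C"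
  shows "(\<integral>\<^sup>+x. f x \<partial>A) + (\<integral>\<^sup>+x. f x \<partial>B) = (\<integral>\<^sup>+x. f x \<partial>C) + (\<integral>\<^sup>+x. f x \<partial>D)"
proof -
  have meas: "borel_measurable A = borel_measurable C" "borel_measurable B = borel_measurable C"
    "borel_measurable D = borel_measurable C"
    using sets by (auto intro: measurable_cong_sets)
  have space: "space A = space C" "space B = space C" "space D = space C"
    using sets by (auto dest: sets_eq_imp_space_eq)
  show ?thesis
    using f
  proof (induction f rule: borel_measurable_induct)
    case (cong f g)
    then show ?case
      by (metis (no_types, lifting) nn_integral_cong space)
  next
    case (set E)
    then show ?case
      using eq sets by simp
  next
    case (mult u c)
    have "c * (integral\<^sup>N A u + integral\<^sup>N B u) = c * (integral\<^sup>N C u + integral\<^sup>N D u)"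
      using mult by simp
    then show ?case
      using mult(2) by (simp only: nn_integral_cmult meas distrib_left)
  next
    case (add u v)
    have "(integral\<^sup>N A u + integral\<^sup>N B u) + (integral\<^sup>N A v + integral\<^sup>N B v)
        = (integral\<^sup>N C u + integral\<^sup>N D u) + (integral\<^sup>N C v + integral\<^sup>N D v)"
      using add by simp
    then show ?case
      using add(1,3) add(4) by (simp only: nn_integral_add meas ac_simps)
  next
    case (seq U)
    have sup: "(\<integral>\<^sup>+x. (SUP i. U i) x \<partial>M) = (SUP i. \<integral>\<^sup>+x. U i x \<partial>M)"
      if "borel_measurable M = (borel_measurable C :: ('a \<Rightarrow> ennreal) set)" for M
      unfolding SUP_apply using seq that
      by (intro nn_integral_monotone_convergence_SUP) auto
    have inc: "incseq (\<lambda>i. \<integral>\<^sup>+x. U i x \<partial>M)" for M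
      using seq(3) by (auto simp: incseq_def le_fun_def intro!: nn_integral_mono)
    \<comment> \<open>After monotone convergence each side is a sum of two suprema of increasing
      sequences. These merge into one supremum, to which the identity for each \<open>U i\<close>
      applies.\<close>
    show ?case
      unfolding sup[OF meas(1)] sup[OF meas(2)] sup[OF refl] sup[OF meas(3)]
      using seq by (simp add: ennreal_SUP_add[OF inc inc, symmetric])
  qed
qed

text \<open>Finiteness of the measures and the bounds on \<open>f\<close> make all four integrals
  finite, so the identity descends from \<open>ennreal\<close> to the reals.\<close>

lemma integral_add_eq_add:
  fixes f :: "'a \<Rightarrow> real"
  assumes sets: "sets A = sets C" "sets B = sets C" "sets D = sets C"
    and fin: "finite_measure A" "finite_measure B" "finite_measure C" "finite_measure D"
    and eq: "\<And>E. E \<in> sets C \<Longrightarrow> measure A E + measure B E = measure C E + measure D E"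
    and f: "f \<in> borel_measurable C"
    and bound: "\<And>x. x \<in> space C \<Longrightarrow> 0 \<le> f x" "\<And>x. x \<in> space C \<Longrightarrow> f x \<le> b"
  shows "(LINT x|A. f x) + (LINT x|B. f x) = (LINT x|C. f x) + (LINT x|D. f x)"
proof -
  have nn: "(\<integral>\<^sup>+x. ennreal (f x) \<partial>M) = ennreal (LINT x|M. f x)" "0 \<le> (LINT x|M. f x)"
    if M: "sets M = sets C" "finite_measure M" for M
  proof -
    interpret finite_measure M by fact
    have sp: "space M = space C" using M(1) by (rule sets_eq_imp_space_eq)
    have "f \<in> borel_measurable M" using f M(1) by (simp cong: measurable_cong_sets)
    then have "integrable M f"
      using bound sp by (intro integrable_const_bound[where B=b]) auto
    then show "(\<integral>\<^sup>+x. ennreal (f x) \<partial>M) = ennreal (LINT x|M. f x)"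
      using bound sp by (intro nn_integral_eq_integral) auto
    show "0 \<le> (LINT x|M. f x)" using bound sp by (intro integral_nonneg_AE) auto
  qed
  have em: "emeasure A E + emeasure B E = emeasure C E + emeasure D E" if "E \<in> sets C" for E
    using eq[OF that] fin
    by (simp add: finite_measure.emeasure_eq_measure flip: ennreal_plus)
  have "ennreal ((LINT x|A. f x) + (LINT x|B. f x)) = ennreal ((LINT x|C. f x) + (LINT x|D. f x))"
    using nn_integral_add_eq_add[OF sets em, of "\<lambda>x. ennreal (f x)"] f
    by (simp add: nn sets fin)
  then show ?thesis
    using nn(2)[OF sets(1) fin(1)] nn(2)[OF sets(2) fin(2)] nn(2)[OF refl fin(3)]
      nn(2)[OF sets(3) fin(4)]
    by (simp add: ennreal_inj del: ennreal_plus)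
qed

section \<open>Jordan decomposition of a difference of finite measures\<close>

text \<open>On a Hahn set \<open>Y\<close> the measure \<open>M\<close> dominates \<open>N\<close>,
  and off \<open>Y\<close> the reverse holds. The positive part is \<open>M - N\<close> on
  \<open>Y\<close>, the negative part \<open>N - M\<close> on \<open>I - Y\<close>. Existence gives
  meaning to the choice made in \<open>signed_integral\<close>.\<close>

lemma jordan_decomposition_signed_diff_exists:
  assumes M: "M \<in> finite_measures_on I" and N: "N \<in> finite_measures_on I"
  shows "\<exists>P Q. jordan_decomposition I (signed_diff M N) P Q"
proof -
  note M = finite_measures_onD[OF M] and N = finite_measures_onD[OF N]
  interpret M: finite_measure M by fact
  interpret N: finite_measure N by fact
  obtain Y where Y: "Y \<in> sets M"
    and YM: "\<forall>X\<in>sets M. X \<subseteq> Y \<longrightarrow> emeasure N X \<le> emeasure M X"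
    and YN: "\<forall>X\<in>sets M. X \<inter> Y = {} \<longrightarrow> emeasure M X \<le> emeasure N X"
    using finite_unsigned_Hahn_decomposition[of M N] M N by auto
  \<comment> \<open>\<open>R K Z\<close> restricts the mass of \<open>K\<close> to \<open>Z\<close>
    but keeps the full sigma-algebra, so that the results are again measures on
    \<open>I\<close>.\<close>
  define R where "R K Z = density K (indicator Z)" for K :: "real measure" and Z
  have R: "emeasure (R K Z) E = emeasure K (Z \<inter> E)" "finite_measure (R K Z)" "sets (R K Z) = sets M"
    if "finite_measure K" "sets K = sets M" "Z \<in> sets M" "E \<in> sets M" for K Z E
  proof -
    have *: "emeasure (R K Z) E = emeasure K (Z \<inter> E)"
      if "E \<in> sets M" for E
      using that \<open>sets K = _\<close> \<open>Z \<in> sets M\<close> emeasure_density[of "indicator Z" K E]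
      by (simp add: R_def indicator_inter_arith[symmetric])
    show "emeasure (R K Z) E = emeasure K (Z \<inter> E)" using that by (intro *)
    show "sets (R K Z) = sets M" by (simp add: R_def that)
    show "finite_measure (R K Z)"
      using *[of "space M"] \<open>sets K = _\<close> \<open>finite_measure K\<close> sets_eq_imp_space_eq[of K M]
      by (intro finite_measureI) (auto simp: R_def finite_measure.emeasure_eq_measure)
  qed
  define Y' where "Y' = I - Y"
  have Y': "Y' \<in> sets M" using Y M by (auto simp: Y'_def)
  \<comment> \<open>Stated for generic \<open>K\<close>, \<open>L\<close>, \<open>Z\<close> in order
    to serve twice: for \<open>M\<close>, \<open>N\<close> on \<open>Y\<close>, and with the roles
    exchanged on \<open>Y'\<close>. The domination \<open>le\<close> makes the difference of the
    restrictions a measure.\<close>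
  have pieces: "finite_measure (diff_measure (R K Z) (R L Z))"
    "sets (diff_measure (R K Z) (R L Z)) = sets M"
    "E \<in> sets M \<Longrightarrow> measure (diff_measure (R K Z) (R L Z)) E = measure K (Z \<inter> E) - measure L (Z \<inter> E)"
    if KL: "finite_measure K" "sets K = sets M" "finite_measure L" "sets L = sets M" "Z \<in> sets M"
      and le: "\<forall>X\<in>sets M. X \<subseteq> Z \<longrightarrow> emeasure L X \<le> emeasure K X" for K L Z E
  proof -
    have top: "space M \<in> sets M" by simp
    have e: "emeasure (diff_measure (R K Z) (R L Z)) E = emeasure K (Z \<inter> E) - emeasure L (Z \<inter> E)"
      if "E \<in> sets M" for E
      using that KL R[OF KL(1,2,5)] R[OF KL(3,4,5)] le
      by (subst emeasure_diff_measure) auto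
    show s: "sets (diff_measure (R K Z) (R L Z)) = sets M"
      using R[OF KL(1,2,5) top] by simp
    have sp: "space (diff_measure (R K Z) (R L Z)) = space M"
      using s by (rule sets_eq_imp_space_eq)
    have r: "emeasure (diff_measure (R K Z) (R L Z)) E = ennreal (measure K (Z \<inter> E) - measure L (Z \<inter> E))"
      if "E \<in> sets M" for E
      using e[OF that] KL by (simp add: finite_measure.emeasure_eq_measure ennreal_minus)
    show "finite_measure (diff_measure (R K Z) (R L Z))"
      using r[OF top] sp by (intro finite_measureI) simp
    assume E: "E \<in> sets M"
    then have "measure L (Z \<inter> E) \<le> measure K (Z \<inter> E)"
      using le KL by (simp add: finite_measure.emeasure_eq_measure)
    then show "measure (diff_measure (R K Z) (R L Z)) E = measure K (Z \<inter> E) - measure L (Z \<inter> E)"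
      using r[OF E] by (simp add: measure_def)
  qed
  define P where "P = diff_measure (R M Y) (R N Y)"
  define Q where "Q = diff_measure (R N Y') (R M Y')"
  have NM: "sets N = sets M" using M N by simp
  note P = pieces[OF M(1) refl N(1) NM Y YM, folded P_def]
  have "\<forall>X\<in>sets M. X \<subseteq> Y' \<longrightarrow> emeasure M X \<le> emeasure N X"
    using YN by (auto simp: Y'_def)
  note Q = pieces[OF N(1) NM M(1) refl Y' this, folded Q_def]
  have "jordan_decomposition I (signed_diff M N) P Q"
    unfolding jordan_decomposition_def
  proof (intro conjI bexI[where x=Y] ballI)
    show "P \<in> finite_measures_on I" "Q \<in> finite_measures_on I"
      using P(1,2) Q(1,2) M by (auto simp: finite_measures_on_def)
    show "measure P (I - Y) = 0"
      using P(3)[of Y'] Y' by (simp add: Y'_def)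
    show "measure Q Y = 0"
      using Q(3)[of Y] Y by (simp add: Y'_def Int_commute)
    show "Y \<in> sets (restrict_space borel I)" using Y M by simp
    fix E assume "E \<in> sets (restrict_space borel I)"
    then have E: "E \<in> sets M" using M by simp
    then have "E \<subseteq> I" using M(3) sets.sets_into_space by blast
    then have EY: "E = (Y \<inter> E) \<union> (Y' \<inter> E)" "(Y \<inter> E) \<inter> (Y' \<inter> E) = {}" by (auto simp: Y'_def)
    have "measure M E = measure M (Y \<inter> E) + measure M (Y' \<inter> E)"
      using M.finite_measure_Union[OF _ _ EY(2)] EY(1) E Y Y' by auto
    moreover have "measure N E = measure N (Y \<inter> E) + measure N (Y' \<inter> E)"
      using N.finite_measure_Union[OF _ _ EY(2)] EY(1) E Y Y' NM by auto
    ultimately show "signed_diff M N E = measure P E - measure Q E"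
      using P(3)[OF E] Q(3)[OF E] by (simp add: signed_diff_def)
  qed
  then show ?thesis by blast
qed

text \<open>Whichever Jordan decomposition \<open>P\<close>, \<open>Q\<close> the choice operator
  picks, \<open>P + N\<close> and \<open>M + Q\<close> agree on Borel sets and hence integrate
  \<open>f\<close> equally. Rearranging removes the choice from the formula.\<close>

lemma signed_integral_signed_diff:
  assumes M: "M \<in> finite_measures_on I" and N: "N \<in> finite_measures_on I"
    and f: "f \<in> borel_measurable (restrict_space borel I)"
    and bound: "\<And>x. x \<in> I \<Longrightarrow> 0 \<le> f x" "\<And>x. x \<in> I \<Longrightarrow> f x \<le> b"
  shows "signed_integral I (signed_diff M N) f = (LINT x|M. f x) - (LINT x|N. f x)"
proof -
  define PQ where "PQ = (SOME (P, Q). jordan_decomposition I (signed_diff M N) P Q)"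
  have "case PQ of (P, Q) \<Rightarrow> jordan_decomposition I (signed_diff M N) P Q"
    unfolding PQ_def
    by (rule someI_ex) (use jordan_decomposition_signed_diff_exists[OF M N] in simp)
  then obtain P Q where PQ: "PQ = (P, Q)" and J: "jordan_decomposition I (signed_diff M N) P Q"
    by (cases PQ) auto
  have PQm: "P \<in> finite_measures_on I" "Q \<in> finite_measures_on I"
    and E: "\<And>E. E \<in> sets (restrict_space borel I) \<Longrightarrow> measure M E - measure N E = measure P E - measure Q E"
    using J by (auto simp: jordan_decomposition_def signed_diff_def)
  note P = finite_measures_onD[OF PQm(1)] and Q = finite_measures_onD[OF PQm(2)]
    and M = finite_measures_onD[OF M] and N = finite_measures_onD[OF N]
  have "(LINT x|P. f x) + (LINT x|N. f x) = (LINT x|M. f x) + (LINT x|Q. f x)"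
  proof (rule integral_add_eq_add)
    show "measure P E + measure N E = measure M E + measure Q E" if "E \<in> sets M" for E
      using E[of E] that M by simp
    show "f \<in> borel_measurable M" using f M by (simp cong: measurable_cong_sets)
  qed (use P Q M N bound in auto)
  then show ?thesis
    by (simp add: signed_integral_def PQ flip: PQ_def)
qed

section \<open>Lipschitz weights and their smoothing\<close>

text \<open>On \<open>{0..<1}\<close> both factors are 1-Lipschitz and bounded by 1, which gives the
  constant 1 + 1. Outside, \<open>f\<close> is arbitrary but \<open>hat\<close> is 0, and
  \<open>hat\<close> decays to 0 at both endpoints fast enough to keep the constant.\<close>

lemma lip_functions_times_hat:
  assumes f: "f \<in> lip_functions"
  shows "2-lipschitz_on UNIV (\<lambda>x. f x * hat x)"
    and "0 \<le> f x * hat x" "f x * hat x \<le> 1/2"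
proof -
  have f01: "0 \<le> f x" "f x \<le> 1" if "x \<in> {0..<1}" for x
    using f that by (auto simp: lip_functions_def)
  have hat: "0 \<le> hat x" "hat x \<le> 1/2" for x
    by (auto simp: hat_def abs_if)
  show "0 \<le> f x * hat x"
    using f01[of x] hat[of x] by (cases "x \<in> {0..<1}") (auto simp: hat_def)
  show "f x * hat x \<le> 1/2"
    using mult_mono[of "f x" 1 "hat x" "1/2"] f01[of x] hat[of x]
    by (cases "x \<in> {0..<1}") (auto simp: hat_def)
  have one: "\<bar>f x * hat x - f y * hat y\<bar> \<le> 2 * \<bar>x - y\<bar>" if x: "x \<in> {0..<1}" for x y
  proof (cases "y \<in> {0..<1}")
    case True
    have "\<bar>f x * hat x - f y * hat y\<bar> = \<bar>f x * (hat x - hat y) + hat y * (f x - f y)\<bar>"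
      by (simp add: algebra_simps)
    also have "\<dots> \<le> \<bar>f x\<bar> * \<bar>hat x - hat y\<bar> + \<bar>hat y\<bar> * \<bar>f x - f y\<bar>"
      by (metis abs_mult abs_triangle_ineq)
    also have "\<dots> \<le> 1 * \<bar>x - y\<bar> + 1 * \<bar>x - y\<bar>"
      using f x True f01[OF x] hat[of y]
      by (intro add_mono mult_mono) (auto simp: lip_functions_def hat_def)
    finally show ?thesis by simp
  next
    case False
    \<comment> \<open>The product vanishes at \<open>y\<close>, and \<open>hat x\<close> is the
      distance from \<open>x\<close> to the nearer of 0 and 1, one of which separates
      \<open>x\<close> from \<open>y\<close>.\<close>
    have "\<bar>f x * hat x - f y * hat y\<bar> \<le> 1 * hat x"
      using False f01[OF x] hat[of x] by (auto simp: hat_def[of y] abs_mult mult_left_le_one_le)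
    also have "\<dots> \<le> \<bar>x - y\<bar>"
      using False x by (auto simp: hat_def)
    also have "\<dots> \<le> 2 * \<bar>x - y\<bar>" by simp
    finally show ?thesis .
  qed
  show "2-lipschitz_on UNIV (\<lambda>x. f x * hat x)"
  proof (rule lipschitz_onI)
    fix x y :: real
    consider "x \<in> {0..<1}" | "y \<in> {0..<1}" | "x \<notin> {0..<1}" "y \<notin> {0..<1}" by blast
    then show "dist (f x * hat x) (f y * hat y) \<le> 2 * dist x y"
      using one[of x y] one[of y x]
      by cases (auto simp: dist_real_def hat_def[of x] hat_def[of y] abs_minus_commute)
  qed simp
qed

text \<open>The mean value theorem for an antiderivative makes the average of \<open>u\<close> over
  \<open>[x, x + \<eta>]\<close> a value of \<open>u\<close> in that interval. In particular the average vanishes at \<open>1\<close>.\<close>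

lemma Lipschitz_C1_approximation:
  fixes u :: "real \<Rightarrow> real"
  assumes lip: "L-lipschitz_on UNIV u" and u1: "\<And>x. 1 \<le> x \<Longrightarrow> u x = 0" and \<eta>: "0 < \<eta>"
  obtains g g' where "\<And>x. x \<in> {0..1} \<Longrightarrow> (g has_real_derivative g' x) (at x)"
    "continuous_on UNIV g'" "\<And>x. \<bar>g' x\<bar> \<le> L" "g 1 = 0"
    "\<And>x. x \<in> {0..1} \<Longrightarrow> \<bar>g x - u x\<bar> \<le> L * \<eta>"
proof -
  have cont: "continuous_on A u" for A
    using lip lipschitz_on_continuous_on continuous_on_subset by blast
  \<comment> \<open>The margins beyond 0 and \<open>\<eta> + 1\<close> make all relevant points
    interior, so that \<open>U\<close> has two-sided derivatives there.\<close>
  obtain U where U: "\<And>x. x \<in> {-1..\<eta> + 2} \<Longrightarrow> (U has_vector_derivative u x) (at x within {-1..\<eta> + 2})"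
    using antiderivative_continuous[OF cont] by metis
  have DU: "(U has_real_derivative u x) (at x)" if "x \<in> {0..\<eta> + 1}" for x
    using U[of x] that at_within_Icc_at[of "-1" x "\<eta> + 2"]
    by (auto simp: has_real_derivative_iff_has_vector_derivative)
  define g where "g x = (U (x + \<eta>) - U x) / \<eta>" for x
  define g' where "g' x = (u (x + \<eta>) - u x) / \<eta>" for x
  have mean: "\<exists>z. x < z \<and> z < x + \<eta> \<and> g x = u z" if "x \<in> {0..1}" for x
  proof -
    have "\<exists>z>x. z < x + \<eta> \<and> U (x + \<eta>) - U x = (x + \<eta> - x) * u z"
      using that \<eta> by (intro MVT2 DU) auto
    then show ?thesis using \<eta> by (auto simp: g_def)
  qed
  have L: "\<bar>u x - u y\<bar> \<le> L * \<bar>x - y\<bar>" for x y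
    using lipschitz_onD[OF lip] by (simp add: dist_real_def)
  show thesis
  proof
    show "(g has_real_derivative g' x) (at x)" if "x \<in> {0..1}" for x
    proof -
      have "((\<lambda>x. U (x + \<eta>)) has_real_derivative u (x + \<eta>)) (at x)"
        using DU[of "x + \<eta>"] that \<eta> by (simp add: DERIV_shift)
      then show ?thesis
        unfolding g_def g'_def
        using that \<eta> by (intro DERIV_cdivide DERIV_diff DU) auto
    qed
    show "continuous_on UNIV g'"
      unfolding g'_def
      using \<eta> by (intro continuous_intros continuous_on_compose2[OF cont[of UNIV]]) auto
    show "\<bar>g' x\<bar> \<le> L" for x
      using L[of "x + \<eta>" x] \<eta> by (simp add: g'_def field_simps)
    show "g 1 = 0" using mean[of 1] u1 by force
    show "\<bar>g x - u x\<bar> \<le> L * \<eta>" if x: "x \<in> {0..1}" for x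
    proof -
      obtain z where "x < z" "z < x + \<eta>" "g x = u z" using mean[OF x] by blast
      then have "\<bar>g x - u x\<bar> \<le> L * \<bar>z - x\<bar>" using L[of z x] by simp
      also have "\<dots> \<le> L * \<eta>"
        using \<open>x < z\<close> \<open>z < x + \<eta>\<close> lipschitz_on_nonneg[OF lip] by (intro mult_left_mono) auto
      finally show ?thesis .
    qed
  qed
qed

section \<open>Increments of integrals along a weak solution\<close>

text \<open>A non-integrable function has integral 0 by convention, so the bound can be applied
  without checking measurability of the integrand.\<close>

lemma abs_integral_le_const:
  fixes f :: "'a \<Rightarrow> real"
  assumes "finite_measure M" "\<And>x. x \<in> space M \<Longrightarrow> \<bar>f x\<bar> \<le> c" "0 \<le> c"
  shows "\<bar>LINT x|M. f x\<bar> \<le> c * measure M (space M)"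
proof (cases "integrable M f")
  case True
  interpret finite_measure M by fact
  show ?thesis
    using order_trans[OF integral_abs_bound
        integral_mono[OF integrable_abs[OF True] integrable_const[of c] assms(2)]]
    by (simp add: mult.commute)
qed (use assms in \<open>simp add: not_integrable_integral_eq\<close>)

text \<open>Since \<alpha> takes values in (0,1], the transport term at time \<open>t\<close> is at
  most \<open>L * mass \<rho> t\<close>. The influx term stays in the bound because
  \<open>g 0\<close> may be nonzero.\<close>

lemma weak_solution_increment_C1:
  assumes T: "0 < T" and \<alpha>: "velocity \<alpha>" and ws: "weak_solution T \<alpha> \<mu> \<rho>0 \<rho>"
    and g: "\<And>x. x \<in> {0..1} \<Longrightarrow> (g has_real_derivative g' x) (at x)"
    and g': "continuous_on UNIV g'" "\<And>x. \<bar>g' x\<bar> \<le> L" and g1: "g 1 = 0"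
    and \<tau>: "\<tau> \<in> {0..T}"
  shows "\<bar>(LINT x|\<rho> \<tau>. g x) - (LINT x|\<rho>0. g x)\<bar>
    \<le> L * integral {0..\<tau>} (mass \<rho>) + \<bar>LINT t:{0<..\<tau>}|\<mu>. g 0\<bar>"
proof -
  define \<psi> where "\<psi> = (\<lambda>t::real. g)"
  have L0: "0 \<le> L" using g'(2)[of 0] by linarith
  \<comment> \<open>The derivative within \<open>{0..T}\<close> is determined because the interval
    is nondegenerate.\<close>
  have dt: "deriv_t T \<psi> t x = 0" if "t \<in> {0..T}" for t x
    unfolding deriv_t_def \<psi>_def
    using that T by (intro vector_derivative_within_closed_interval) auto
  have dx: "deriv_x \<psi> t x = g' x" if "x \<in> {0..1}" for t x
    unfolding deriv_x_def \<psi>_def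
    using that g[OF that, THEN has_field_derivative_at_within]
    by (intro vector_derivative_within_closed_interval)
      (auto simp: has_real_derivative_iff_has_vector_derivative)
  have test: "\<psi> \<in> test_functions T"
    unfolding test_functions_def
  proof (intro CollectI conjI ballI)
    show "\<psi> t 1 = 0" for t by (simp add: \<psi>_def g1)
    show "\<psi> t differentiable_on {0..1}" for t
      using g unfolding \<psi>_def
      by (intro differentiable_at_imp_differentiable_on) (auto simp: real_differentiable_def)
    have "continuous_on ({0..T} \<times> {0..1}) (\<lambda>p. g' (snd p))"
      by (intro continuous_on_compose2[OF g'(1)] continuous_intros) auto
    then show "continuous_on ({0..T} \<times> {0..1}) (\<lambda>(t, x). deriv_x \<psi> t x)"
      by (rule continuous_on_eq) (auto simp: dx)
    show "\<exists>L. L-lipschitz_on {0..T} (\<lambda>t. \<psi> t x)" for x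
      by (auto simp: \<psi>_def intro!: exI[of _ 0] lipschitz_onI)
  qed
  have \<rho>: "finite_measure (\<rho> t)" "space (\<rho> t) = {0..<1}" if "t \<in> {0..T}" for t
    using ws that finite_measures_onD[of "\<rho> t" "{0..<1}"] by (auto simp: weak_solution_def)
  \<comment> \<open>The time derivative is 0 throughout \<open>{0..T}\<close>, so the guard of the
    weak identity reduces to integrability of zero.\<close>
  have "deriv_t_integrable T \<rho> \<psi> \<tau>"
    unfolding deriv_t_integrable_def
  proof
    show "AE t in lebesgue. t \<in> {0<..\<tau>} \<longrightarrow> integrable (\<rho> t) (deriv_t T \<psi> t)"
    proof (intro AE_I2 impI)
      fix t assume "t \<in> {0<..\<tau>}"
      then have "deriv_t T \<psi> t = (\<lambda>x. 0)" using dt \<tau> by auto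
      then show "integrable (\<rho> t) (deriv_t T \<psi> t)" by simp
    qed
    have "set_integrable lebesgue {0<..\<tau>} (\<lambda>t. LINT x|\<rho> t. \<bar>deriv_t T \<psi> t x\<bar>)
      \<longleftrightarrow> set_integrable lebesgue {0<..\<tau>} (\<lambda>t. 0::real)"
      using dt \<tau> by (intro set_integrable_cong) auto
    then show "set_integrable lebesgue {0<..\<tau>} (\<lambda>t. LINT x|\<rho> t. \<bar>deriv_t T \<psi> t x\<bar>)"
      by (simp add: set_integrable_def)
  qed
  moreover define J where
    "J t = (LINT x|\<rho> t. deriv_t T \<psi> t x + \<alpha> (mass \<rho> t) * deriv_x \<psi> t x)" for t
  ultimately have J: "set_integrable lebesgue {0<..\<tau>} J"
    and eq: "0 = (LINT t:{0<..\<tau>}|lebesgue. J t) + (LINT t:{0<..\<tau>}|\<mu>. g 0)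
          - (LINT x|\<rho> \<tau>. g x) + (LINT x|\<rho>0. g x)"
    using ws test \<tau> unfolding weak_solution_def \<psi>_def J_def by blast+
  have Jb: "\<bar>J t\<bar> \<le> L * mass \<rho> t" if t: "t \<in> {0<..\<tau>}" for t
  proof -
    have t': "t \<in> {0..T}" using t \<tau> by auto
    have \<alpha>1: "0 \<le> \<alpha> (mass \<rho> t)" "\<alpha> (mass \<rho> t) \<le> 1"
      using \<alpha> by (auto simp: velocity_def image_subset_iff less_imp_le)
    have "\<bar>J t\<bar> \<le> L * measure (\<rho> t) (space (\<rho> t))"
      unfolding J_def
    proof (rule abs_integral_le_const)
      fix x assume "x \<in> space (\<rho> t)"
      then have "deriv_x \<psi> t x = g' x" using dx \<rho>[OF t'] by auto
      then show "\<bar>deriv_t T \<psi> t x + \<alpha> (mass \<rho> t) * deriv_x \<psi> t x\<bar> \<le> L"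
        using mult_mono[OF \<alpha>1(2) g'(2)[of x]] \<alpha>1 by (simp add: dt[OF t'] abs_mult)
    qed (use \<rho>[OF t'] L0 in auto)
    then show ?thesis using \<rho>[OF t'] by simp
  qed
  have W0: "set_integrable lebesgue {0<..\<tau>} (mass \<rho>)"
    using ws \<tau> by (auto simp: weak_solution_def intro: set_integrable_subset)
  have W: "set_integrable lebesgue {0<..\<tau>} (\<lambda>t. L * mass \<rho> t)"
    using W0 by simp
  have W': "set_integrable lebesgue {0..\<tau>} (mass \<rho>)"
    using ws \<tau> by (auto simp: weak_solution_def intro: set_integrable_subset)
  have "\<bar>LINT t:{0<..\<tau>}|lebesgue. J t\<bar> \<le> (LINT t:{0<..\<tau>}|lebesgue. L * mass \<rho> t)"
    using J W Jb unfolding set_integrable_def set_lebesgue_integral_def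
    by (intro integral_abs_bound_integral) (auto simp: indicator_def)
  \<comment> \<open>The bound passes to the gauge integral and then to the closed interval, which
    differs by a null set. In this form the continuity of the indefinite integral applies.\<close>
  also have "\<dots> = L * integral {0<..\<tau>} (mass \<rho>)"
    using set_lebesgue_integral_eq_integral(2)[OF W0] by simp
  also have "integral {0<..\<tau>} (mass \<rho>) = integral {0..\<tau>} (mass \<rho>)"
  proof (rule integral_subset_negligible)
    show "negligible ({0..\<tau>} - {0<..\<tau>})"
      by (rule negligible_subset[OF negligible_sing[of 0]]) auto
  qed auto
  finally show ?thesis using eq by linarith
qed

text \<open>The C1 bound is applied to \<open>g\<close> within \<open>L * \<eta>\<close> of
  \<open>u\<close>, and \<open>\<eta>\<close> tends to 0. As \<open>u 0 = 0\<close>, also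
  \<open>g 0\<close> is of order \<open>\<eta>\<close>, so the influx term disappears in the
  limit.\<close>

lemma weak_solution_increment_Lipschitz:
  assumes T: "0 < T" and \<alpha>: "velocity \<alpha>" and \<mu>: "\<mu> \<in> finite_measures_on {0<..T}"
    and \<rho>0: "\<rho>0 \<in> finite_measures_on {0..<1}" and ws: "weak_solution T \<alpha> \<mu> \<rho>0 \<rho>"
    and u: "L-lipschitz_on UNIV u" "u 0 = 0" "\<And>x. 1 \<le> x \<Longrightarrow> u x = 0"
    and \<tau>: "\<tau> \<in> {0..T}"
  shows "\<bar>(LINT x|\<rho> \<tau>. u x) - (LINT x|\<rho>0. u x)\<bar> \<le> L * integral {0..\<tau>} (mass \<rho>)"
proof -
  have \<rho>\<tau>: "\<rho> \<tau> \<in> finite_measures_on {0..<1}"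
    using ws \<tau> by (auto simp: weak_solution_def)
  have L0: "0 \<le> L" using u(1) by (rule lipschitz_on_nonneg)
  \<comment> \<open>Integrability of \<open>g\<close> and \<open>u\<close> is needed to split the
    integral of \<open>g x - u x\<close>.\<close>
  have int: "integrable M v"
    if M: "M \<in> finite_measures_on {0..<1}" and v: "continuous_on {0..1} v"
    for M and v :: "real \<Rightarrow> real"
  proof -
    interpret finite_measure M using M by (rule finite_measures_onD)
    have "bounded (v ` {0..1})"
      by (intro compact_imp_bounded compact_continuous_image v compact_Icc)
    then obtain B where B: "\<And>x. x \<in> {0..1} \<Longrightarrow> norm (v x) \<le> B"
      unfolding bounded_iff by blast
    have "v \<in> borel_measurable (restrict_space borel {0..<1})"
      using v by (intro borel_measurable_continuous_on_restrict) (auto intro: continuous_on_subset)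
    then have "v \<in> borel_measurable M"
      using finite_measures_onD[OF M] by (simp cong: measurable_cong_sets)
    then show ?thesis
      using B finite_measures_onD[OF M] by (intro integrable_const_bound[where B=B]) auto
  qed
  have contu: "continuous_on {0..1} u"
    using u(1) lipschitz_on_continuous_on continuous_on_subset by blast
  \<comment> \<open>The three masses account for replacing \<open>u\<close> by \<open>g\<close>
    under \<open>\<rho> \<tau>\<close> and \<open>\<rho>0\<close>, and for the influx weighted by
    \<open>g 0\<close>. Each error is at most \<open>L * \<eta>\<close> times its mass.\<close>
  define c where "c = L * (mass \<rho> \<tau> + measure \<rho>0 {0..<1} + measure \<mu> {0<..T})"
  have *: "\<bar>(LINT x|\<rho> \<tau>. u x) - (LINT x|\<rho>0. u x)\<bar> \<le> L * integral {0..\<tau>} (mass \<rho>) + c * \<eta>"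
    if \<eta>: "0 < \<eta>" for \<eta>
  proof -
    obtain g g' where g: "\<And>x. x \<in> {0..1} \<Longrightarrow> (g has_real_derivative g' x) (at x)"
      "continuous_on UNIV g'" "\<And>x. \<bar>g' x\<bar> \<le> L" "g 1 = 0"
      and gu: "\<And>x. x \<in> {0..1} \<Longrightarrow> \<bar>g x - u x\<bar> \<le> L * \<eta>"
      using Lipschitz_C1_approximation[OF u(1,3) \<eta>] by metis
    have contg: "continuous_on {0..1} g"
      by (intro continuous_at_imp_continuous_on ballI) (use g(1) in \<open>metis DERIV_isCont\<close>)
    have close: "\<bar>(LINT x|M. g x) - (LINT x|M. u x)\<bar> \<le> L * \<eta> * measure M {0..<1}"
      if M: "M \<in> finite_measures_on {0..<1}" for M
      using abs_integral_le_const[of M "\<lambda>x. g x - u x" "L * \<eta>"] gu L0 \<eta>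
        finite_measures_onD[OF M] int[OF M contg] int[OF M contu] by simp
    interpret \<mu>: finite_measure \<mu> using \<mu> by (rule finite_measures_onD)
    have "\<bar>LINT t:{0<..\<tau>}|\<mu>. g 0\<bar> \<le> L * \<eta> * measure \<mu> {0<..T}"
      using abs_integral_le_const[of \<mu> "\<lambda>t. indicator {0<..\<tau>} t * g 0" "L * \<eta>"]
        gu[of 0] u(2) L0 \<eta> finite_measures_onD[OF \<mu>]
      by (simp add: set_lebesgue_integral_def indicator_def)
    then show ?thesis
      using weak_solution_increment_C1[OF T \<alpha> ws g \<tau>] close[OF \<rho>\<tau>] close[OF \<rho>0]
      by (simp add: c_def algebra_simps)
  qed
  have "((\<lambda>\<eta>. L * integral {0..\<tau>} (mass \<rho>) + c * \<eta>) \<longlongrightarrow> L * integral {0..\<tau>} (mass \<rho>) + c * 0)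
      (at_right 0)"
    by (intro tendsto_intros)
  moreover have "\<forall>\<^sub>F \<eta> in at_right 0.
      \<bar>(LINT x|\<rho> \<tau>. u x) - (LINT x|\<rho>0. u x)\<bar> \<le> L * integral {0..\<tau>} (mass \<rho>) + c * \<eta>"
    by (rule eventually_mono[OF eventually_at_right_less[of 0]]) (rule *)
  ultimately have "\<bar>(LINT x|\<rho> \<tau>. u x) - (LINT x|\<rho>0. u x)\<bar> \<le> L * integral {0..\<tau>} (mass \<rho>) + c * 0"
    by (rule tendsto_lowerbound) simp
  then show ?thesis by simp
qed

text \<open>The definition provides integrability of the mass in time rather than a bound, so
  smallness comes from continuity at 0 of the indefinite integral.\<close>

lemma weak_solution_integral_mass_small:
  assumes T: "0 < T" and ws: "weak_solution T \<alpha> \<mu> \<rho>0 \<rho>" and \<epsilon>: "0 < \<epsilon>"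
  obtains \<tau> where "0 < \<tau>" "\<And>t. t \<in> {0..T} \<Longrightarrow> t < \<tau> \<Longrightarrow> integral {0..t} (mass \<rho>) < \<epsilon>"
proof -
  have "mass \<rho> integrable_on {0..T}"
    using ws by (auto simp: weak_solution_def dest: set_lebesgue_integral_eq_integral(1))
  then have "continuous_on {0..T} (\<lambda>t. integral {0..t} (mass \<rho>))"
    by (rule indefinite_integral_continuous_1)
  then obtain d where "0 < d"
    "\<And>t. t \<in> {0..T} \<Longrightarrow> dist t 0 < d \<Longrightarrow> dist (integral {0..t} (mass \<rho>)) (integral {0..0} (mass \<rho>)) < \<epsilon>"
    using T \<epsilon> unfolding continuous_on_iff by (metis atLeastAtMost_iff less_imp_le order_refl)
  then show thesis by (intro that[of d]) (force simp: dist_real_def)+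
qed

section \<open>Estimates in the seminorm \<open>phi\<close>\<close>

text \<open>The nonnegative bounded weights \<open>f * hat\<close> allow the signed integral to be
  replaced by a difference of ordinary integrals.\<close>

lemma phi_signed_diff:
  assumes M: "M \<in> finite_measures_on {0..<1}" and N: "N \<in> finite_measures_on {0..<1}"
  shows "phi (signed_diff M N)
      = (SUP f\<in>lip_functions. \<bar>(LINT x|M. f x * hat x) - (LINT x|N. f x * hat x)\<bar>)"
    and "f \<in> lip_functions \<Longrightarrow>
      \<bar>(LINT x|M. f x * hat x) - (LINT x|N. f x * hat x)\<bar> \<le> phi (signed_diff M N)"
proof -
  have "signed_integral {0..<1} (signed_diff M N) (\<lambda>x. f x * hat x)
      = (LINT x|M. f x * hat x) - (LINT x|N. f x * hat x)" if f: "f \<in> lip_functions" for f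
  proof (rule signed_integral_signed_diff[OF M N, where b="1/2"])
    show "(\<lambda>x. f x * hat x) \<in> borel_measurable (restrict_space borel {0..<1})"
      using lipschitz_on_continuous_on[OF lip_functions_times_hat(1)[OF f]]
      by (intro borel_measurable_continuous_on_restrict) (auto intro: continuous_on_subset)
  qed (use lip_functions_times_hat[OF f] in auto)
  then show eq: "phi (signed_diff M N)
      = (SUP f\<in>lip_functions. \<bar>(LINT x|M. f x * hat x) - (LINT x|N. f x * hat x)\<bar>)"
    by (auto simp: phi_def)
  have bound: "\<bar>LINT x|K. f x * hat x\<bar> \<le> 1/2 * measure K (space K)"
    if "f \<in> lip_functions" "finite_measure K" for f K
    using that lip_functions_times_hat(2,3)[of f] by (intro abs_integral_le_const) auto
  \<comment> \<open>A real \<open>SUP\<close> dominates its members once the family is bounded. As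
    the weights lie between 0 and 1/2, half the sum of the total masses is a bound.\<close>
  have "bdd_above ((\<lambda>f. \<bar>(LINT x|M. f x * hat x) - (LINT x|N. f x * hat x)\<bar>) ` lip_functions)"
    using bound[OF _ finite_measures_onD(1)[OF M]] bound[OF _ finite_measures_onD(1)[OF N]]
    by (intro bdd_aboveI2[where M="1/2 * measure M (space M) + 1/2 * measure N (space N)"]) force
  then show "\<bar>(LINT x|M. f x * hat x) - (LINT x|N. f x * hat x)\<bar> \<le> phi (signed_diff M N)"
    if "f \<in> lip_functions"
    unfolding eq by (rule cSUP_upper[OF that])
qed

text \<open>Triangle inequality through the initial data: tested against \<open>f * hat\<close>,
  each solution moves by at most 2 times its integrated mass, 2 being the Lipschitz constant of the
  weight.\<close>

lemma phi_weak_solutions_le: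
  assumes T: "0 < T" and \<alpha>: "velocity \<alpha>" and \<mu>: "\<mu> \<in> finite_measures_on {0<..T}"
    and \<rho>0: "\<rho>0 \<in> finite_measures_on {0..<1}" and ws: "weak_solution T \<alpha> \<mu> \<rho>0 \<rho>"
    and \<rho>0': "\<rho>0' \<in> finite_measures_on {0..<1}" and ws': "weak_solution T \<alpha> \<mu> \<rho>0' \<rho>'"
    and t: "t \<in> {0..T}"
  shows "phi (signed_diff (\<rho>' t) (\<rho> t)) \<le> phi (signed_diff \<rho>0' \<rho>0)
    + 2 * integral {0..t} (mass \<rho>') + 2 * integral {0..t} (mass \<rho>)"
proof -
  have \<rho>t: "\<rho> t \<in> finite_measures_on {0..<1}" "\<rho>' t \<in> finite_measures_on {0..<1}"
    using ws ws' t by (auto simp: weak_solution_def)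
  have "(\<lambda>x. 0) \<in> lip_functions" by (auto simp: lip_functions_def)
  then have ne: "lip_functions \<noteq> {}" by blast
  show ?thesis
    unfolding phi_signed_diff(1)[OF \<rho>t(2,1)]
  proof (rule cSUP_least[OF ne])
    fix f assume f: "f \<in> lip_functions"
    \<comment> \<open>Vanishing at 0 suppresses the influx, and vanishing from 1 onwards makes the
      smoothed weights admissible test functions.\<close>
    have z: "f 0 * hat 0 = 0" "\<And>x. 1 \<le> x \<Longrightarrow> f x * hat x = 0" by (auto simp: hat_def)
    show "\<bar>(LINT x|\<rho>' t. f x * hat x) - (LINT x|\<rho> t. f x * hat x)\<bar>
      \<le> phi (signed_diff \<rho>0' \<rho>0) + 2 * integral {0..t} (mass \<rho>') + 2 * integral {0..t} (mass \<rho>)"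
      using weak_solution_increment_Lipschitz[OF T \<alpha> \<mu> \<rho>0 ws lip_functions_times_hat(1)[OF f] z t]
        weak_solution_increment_Lipschitz[OF T \<alpha> \<mu> \<rho>0' ws' lip_functions_times_hat(1)[OF f] z t]
        phi_signed_diff(2)[OF \<rho>0' \<rho>0 f]
      by linarith
  qed
qed

theorem theorem4p15:
  fixes T :: real and \<alpha> :: "real \<Rightarrow> real"
    and \<mu> \<rho>0 :: "real measure" and \<rho> :: "real \<Rightarrow> real measure"
  assumes "0 < T"
    and "velocity \<alpha>"
    and "\<mu> \<in> finite_measures_on {0<..T}" and "zero_sing_cont_part {0<..T} \<mu>"
    and "\<rho>0 \<in> finite_measures_on {0..<1}" and "zero_sing_cont_part {0..<1} \<rho>0"
    and "weak_solution T \<alpha> \<mu> \<rho>0 \<rho>"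
  shows "\<forall>\<rho>0'\<in>finite_measures_on {0..<1}. zero_sing_cont_part {0..<1} \<rho>0' \<longrightarrow>
    (\<forall>\<rho>'. weak_solution T \<alpha> \<mu> \<rho>0' \<rho>' \<longrightarrow>
      (\<forall>\<epsilon>>0. \<exists>\<delta>>0. \<exists>\<tau>>0. phi (signed_diff \<rho>0' \<rho>0) < \<delta> \<longrightarrow>
        (\<forall>t\<in>{0..T}. t < \<tau> \<longrightarrow> phi (signed_diff (\<rho>' t) (\<rho> t)) < \<epsilon>)))"
proof (intro ballI allI impI)
  fix \<rho>0' \<rho>' and \<epsilon> :: real
  assume \<rho>0': "\<rho>0' \<in> finite_measures_on {0..<1}" and ws': "weak_solution T \<alpha> \<mu> \<rho>0' \<rho>'" and \<epsilon>: "0 < \<epsilon>"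
  \<comment> \<open>Two integrals, each with factor 2 and below \<open>\<epsilon> / 8\<close>,
    contribute less than \<open>\<epsilon> / 2\<close>. The initial distance takes the other
    half.\<close>
  have \<epsilon>8: "0 < \<epsilon> / 8" using \<epsilon> by simp
  obtain \<tau>1 where \<tau>1: "0 < \<tau>1" "\<And>t. t \<in> {0..T} \<Longrightarrow> t < \<tau>1 \<Longrightarrow> integral {0..t} (mass \<rho>) < \<epsilon> / 8"
    using weak_solution_integral_mass_small[OF assms(1,7) \<epsilon>8] by metis
  \<comment> \<open>This time depends on the perturbed solution \<open>\<rho>'\<close>, which is
    fixed before \<open>\<tau>\<close> is chosen.\<close>
  obtain \<tau>2 where \<tau>2: "0 < \<tau>2" "\<And>t. t \<in> {0..T} \<Longrightarrow> t < \<tau>2 \<Longrightarrow> integral {0..t} (mass \<rho>') < \<epsilon> / 8"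
    using weak_solution_integral_mass_small[OF assms(1) ws' \<epsilon>8] by metis
  have "phi (signed_diff \<rho>0' \<rho>0) < \<epsilon> / 2 \<longrightarrow>
      (\<forall>t\<in>{0..T}. t < min \<tau>1 \<tau>2 \<longrightarrow> phi (signed_diff (\<rho>' t) (\<rho> t)) < \<epsilon>)"
  proof (intro impI ballI)
    fix t assume "phi (signed_diff \<rho>0' \<rho>0) < \<epsilon> / 2" and t: "t \<in> {0..T}" "t < min \<tau>1 \<tau>2"
    then show "phi (signed_diff (\<rho>' t) (\<rho> t)) < \<epsilon>"
      using phi_weak_solutions_le[OF assms(1-3,5,7) \<rho>0' ws' t(1)] \<tau>1(2)[of t] \<tau>2(2)[of t] by linarith
  qed
  moreover have "0 < \<epsilon> / 2" "0 < min \<tau>1 \<tau>2" using \<epsilon> \<tau>1(1) \<tau>2(1) by auto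
  ultimately show "\<exists>\<delta>>0. \<exists>\<tau>>0. phi (signed_diff \<rho>0' \<rho>0) < \<delta> \<longrightarrow>
        (\<forall>t\<in>{0..T}. t < \<tau> \<longrightarrow> phi (signed_diff (\<rho>' t) (\<rho> t)) < \<epsilon>)"
    by blast
qed

end
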